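(* Let $n$ be a positive integer and $x\in G=\mathbb{B}^n$. (1) Let $R>0$. For radii $t_0,t_1>0$, the inclusions $B_s(x,t_0)\subseteq B_\rho(x,R)\subseteq B_s(x,t_1)$ can hold only if $$0<t_0\leq\frac{\tanh(R/2)(1-|x|^2)}{2(1-|x|\tanh(R/2))-\big|2|x|-\tanh(R/2)(1+|x|^2)\big|}\quad\text{and}\quad t_1\geq\frac{(1+|x|)(e^R-1)}{3+e^R+|x|(e^R-1)}.$$ (2) Let $0<t<1$. For radii $R_0,R_1>0$, the inclusions $B_\rho(x,R_0)\subseteq B_s(x,t)\subseteq B_\rho(x,R_1)$ can hold only if $$0<R_0\leq\log\left(1+\frac{4t}{(1-t)(1+|x|)}\right)\quad\text{and}\quad R_1\geq2\,\mathrm{arsinh}\left(\frac{2t}{\sqrt{l(t,|x|)}}\right),$$ where $$l(t,|x|)=\max\{(1+t)(1+|x|)(1-3t+|x|(1+t)),\ (1-t)(1-|x|)(1+3t-|x|(1-t))\}.$$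
   Context: $\mathbb{B}^n$ is the open Euclidean unit ball of $\mathbb{R}^n$ with boundary $S^{n-1}$. The triangular ratio metric in $\mathbb{B}^n$ is $s_{\mathbb{B}^n}(x,y)=\dfrac{|x-y|}{\inf_{z\in S^{n-1}}(|x-z|+|z-y|)}$, and the hyperbolic metric $\rho_{\mathbb{B}^n}$ is given by $\sinh^2\dfrac{\rho_{\mathbb{B}^n}(x,y)}{2}=\dfrac{|x-y|^2}{(1-|x|^2)(1-|y|^2)}$. The balls are $B_s(x,r)=\{y\in\mathbb{B}^n : s_{\mathbb{B}^n}(x,y)<r\}$ and $B_\rho(x,r)=\{y\in\mathbb{B}^n : \rho_{\mathbb{B}^n}(x,y)<r\}$. *)

theory Defs
  imports "HOL-Analysis.Analysis"
begin

definition triangular_ratio_ball :: "real ^ 'n \<Rightarrow> real ^ 'n \<Rightarrow> real" where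
  "triangular_ratio_ball x y =
     norm (x - y) / (INF z \<in> sphere 0 1. norm (x - z) + norm (z - y))"

(* The defining identity fixes the distance only up to sign, hence the nonnegativity
   requirement.  The description is meaningful only for points of the open unit ball;
   see the two lemmas below. *)
definition hyperbolic_dist_ball :: "real ^ 'n \<Rightarrow> real ^ 'n \<Rightarrow> real" where
  "hyperbolic_dist_ball x y =
     (THE r. 0 \<le> r \<and>
        (sinh (r / 2))\<^sup>2 = (norm (x - y))\<^sup>2 / ((1 - (norm x)\<^sup>2) * (1 - (norm y)\<^sup>2)))"

definition s_ball :: "real ^ 'n \<Rightarrow> real \<Rightarrow> (real ^ 'n) set" where
  "s_ball x r = {y \<in> ball 0 1. triangular_ratio_ball x y < r}"

definition rho_ball :: "real ^ 'n \<Rightarrow> real \<Rightarrow> (real ^ 'n) set" where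
  "rho_ball x r = {y \<in> ball 0 1. hyperbolic_dist_ball x y < r}"

definition l_fun :: "real \<Rightarrow> real \<Rightarrow> real" where
  "l_fun t a = max ((1 + t) * (1 + a) * (1 - 3 * t + a * (1 + t)))
                   ((1 - t) * (1 - a) * (1 + 3 * t - a * (1 - t)))"

lemma hyperbolic_dist_ball_ex1:
  fixes x y :: "real ^ 'n"
  assumes "x \<in> ball 0 1" "y \<in> ball 0 1"
  shows "\<exists>!r. 0 \<le> r \<and>
    (sinh (r / 2))\<^sup>2 = (norm (x - y))\<^sup>2 / ((1 - (norm x)\<^sup>2) * (1 - (norm y)\<^sup>2))"
proof -
  define q where "q = (norm (x - y))\<^sup>2 / ((1 - (norm x)\<^sup>2) * (1 - (norm y)\<^sup>2))"
  have "(norm x)\<^sup>2 < 1" "(norm y)\<^sup>2 < 1"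
    using assms by (simp_all add: power_less_one_iff)
  then have q: "0 \<le> q" by (simp add: q_def)
  have "\<exists>!r. 0 \<le> r \<and> (sinh (r / 2))\<^sup>2 = q"
  proof (rule ex1I[of _ "2 * arsinh (sqrt q)"])
    show "0 \<le> 2 * arsinh (sqrt q) \<and> (sinh (2 * arsinh (sqrt q) / 2))\<^sup>2 = q"
      using q sinh_real_nonneg_iff[of "arsinh (sqrt q)"] by simp
  next
    fix r :: real
    assume r: "0 \<le> r \<and> (sinh (r / 2))\<^sup>2 = q"
    then have "sqrt q = sinh (r / 2)"
      by (intro real_sqrt_unique) auto
    then show "r = 2 * arsinh (sqrt q)"
      using arsinh_sinh_real[of "r / 2"] by simp
  qed
  then show ?thesis by (simp add: q_def)
qed

lemma hyperbolic_dist_ball_sinh: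
  fixes x y :: "real ^ 'n"
  assumes "x \<in> ball 0 1" "y \<in> ball 0 1"
  shows "0 \<le> hyperbolic_dist_ball x y"
    and "(sinh (hyperbolic_dist_ball x y / 2))\<^sup>2 =
           (norm (x - y))\<^sup>2 / ((1 - (norm x)\<^sup>2) * (1 - (norm y)\<^sup>2))"
  using theI'[OF hyperbolic_dist_ball_ex1[OF assms]]
  unfolding hyperbolic_dist_ball_def by blast+

end

theory Submission
  imports Defs
begin

text \<open>
  Every bound comes from testing the inclusions on the diameter through the centre
  \<open>x = a e\<close>, where \<open>e\<close> is a unit vector and \<open>a = |x|\<close>.  On that diameter both metrics are
  explicit.  For \<open>y = b e\<close> the infimum defining \<open>s\<close> is attained at one of the endpoints
  \<open>e\<close>, \<open>-e\<close>, since \<open>|x - z| + |z - y| \<ge> |2z - (x + y)| \<ge> 2 - |x + y|\<close> for unit \<open>z\<close>; hence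
  \<open>s(x,y) = |a - b| / (2 - |a + b|)\<close> (\<open>triangular_ratio_ball_diameter\<close>).  The identity
  \<open>(1 - a\<^sup>2)(1 - b\<^sup>2) = (1 - ab)\<^sup>2 - (a - b)\<^sup>2\<close> turns the formula for \<open>\<rho>\<close> into
  \<open>tanh (\<rho>(x,y)/2) = |a - b| / (1 - ab)\<close> (\<open>rho_ball_diameter_tanh\<close>).  Both balls thus meet
  the diameter in intervals with computable endpoints.

  The bound on \<open>t\<^sub>0\<close> is the value of \<open>s\<close> at the endpoint of the \<open>\<rho>\<close>-interval in the
  direction \<open>-e\<close> (\<open>s_ball_subset_rho_ball_imp_triangular_radius_le\<close>), and the bound on \<open>t\<^sub>1\<close>
  is its value at the endpoint in the direction \<open>e\<close>
  (\<open>rho_ball_subset_s_ball_imp_radii_inequality\<close>).  Solving the latter bound for the hyperbolic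
  radius gives the bound on \<open>R\<^sub>0\<close>.  For \<open>R\<^sub>1\<close> one evaluates \<open>\<rho>\<close> at the endpoint of the
  \<open>s\<close>-interval in the direction \<open>-e\<close>
  (\<open>s_ball_subset_rho_ball_imp_hyperbolic_radius_ge\<close>).  Because of the absolute value
  \<open>|a + b|\<close> this endpoint is the larger of two candidates, which correspond to the two entries
  of the maximum in \<open>l\<close>.
\<close>

section \<open>The two metrics on a diameter\<close>

lemma triangular_ratio_ball_diameter:
  fixes e :: "real ^ 'n"
  assumes e: "norm e = 1" and a: "\<bar>a\<bar> < 1" and b: "\<bar>b\<bar> < 1"
  shows "triangular_ratio_ball (a *\<^sub>R e) (b *\<^sub>R e) = \<bar>a - b\<bar> / (2 - \<bar>a + b\<bar>)"
proof -
  let ?f = "\<lambda>z. norm (a *\<^sub>R e - z) + norm (z - b *\<^sub>R e)"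
  have lower: "2 - \<bar>a + b\<bar> \<le> ?f z" if "z \<in> sphere 0 1" for z
  proof -
    have "2 = norm (2 *\<^sub>R z)" using that by simp
    also have "\<dots> = norm ((a + b) *\<^sub>R e - (a *\<^sub>R e - z) + (z - b *\<^sub>R e))"
      by (simp add: algebra_simps scaleR_2)
    also have "\<dots> \<le> norm ((a + b) *\<^sub>R e) + norm (a *\<^sub>R e - z) + norm (z - b *\<^sub>R e)"
      by (meson norm_triangle_ineq norm_triangle_ineq4 add_right_mono order_trans)
    finally show ?thesis using e by simp
  qed
  \<comment> \<open>The endpoint of the diameter on the same side as the midpoint of the two points.\<close>
  define s :: real where "s = (if a + b \<ge> 0 then 1 else - 1)"
  have attained: "?f (s *\<^sub>R e) = 2 - \<bar>a + b\<bar>"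
  proof -
    have "?f (s *\<^sub>R e) = \<bar>a - s\<bar> + \<bar>s - b\<bar>"
      using e by (simp flip: scaleR_diff_left)
    then show ?thesis using a b by (auto simp: s_def)
  qed
  have "s *\<^sub>R e \<in> sphere 0 1" using e by (simp add: s_def)
  then have "(INF z \<in> sphere 0 1. ?f z) = 2 - \<bar>a + b\<bar>"
    using lower attained by (intro cInf_eq_minimum) (auto intro!: image_eqI[of _ _ "s *\<^sub>R e"])
  moreover have "norm (a *\<^sub>R e - b *\<^sub>R e) = \<bar>a - b\<bar>"
    using e by (simp flip: scaleR_diff_left)
  ultimately show ?thesis by (simp add: triangular_ratio_ball_def)
qed

lemma s_ball_diameter:
  fixes e :: "real ^ 'n"
  assumes e: "norm e = 1" and a: "\<bar>a\<bar> < 1" and b: "\<bar>b\<bar> < 1"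
  shows "b *\<^sub>R e \<in> s_ball (a *\<^sub>R e) t \<longleftrightarrow> \<bar>a - b\<bar> < t * (2 - \<bar>a + b\<bar>)"
proof -
  have "2 - \<bar>a + b\<bar> > 0" using a b by linarith
  then show ?thesis
    using triangular_ratio_ball_diameter[OF assms] e b by (simp add: s_ball_def divide_less_eq)
qed

lemma rho_ball_diameter_sinh:
  fixes e :: "real ^ 'n"
  assumes e: "norm e = 1" and a: "\<bar>a\<bar> < 1" and b: "\<bar>b\<bar> < 1" and R: "R > 0"
  shows "b *\<^sub>R e \<in> rho_ball (a *\<^sub>R e) R \<longleftrightarrow>
    (a - b)\<^sup>2 < (sinh (R / 2))\<^sup>2 * ((1 - a\<^sup>2) * (1 - b\<^sup>2))"
proof -
  define r where "r = hyperbolic_dist_ball (a *\<^sub>R e) (b *\<^sub>R e)"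
  have mem: "a *\<^sub>R e \<in> ball 0 1" "b *\<^sub>R e \<in> ball 0 1" using e a b by auto
  have pos: "(1 - a\<^sup>2) * (1 - b\<^sup>2) > 0" using a b by (simp add: abs_square_less_1)
  have r0: "0 \<le> r" and r: "(sinh (r / 2))\<^sup>2 = (a - b)\<^sup>2 / ((1 - a\<^sup>2) * (1 - b\<^sup>2))"
    using hyperbolic_dist_ball_sinh[OF mem] e by (simp_all add: r_def flip: scaleR_diff_left)
  have "b *\<^sub>R e \<in> rho_ball (a *\<^sub>R e) R \<longleftrightarrow> r < R"
    using mem by (simp add: rho_ball_def r_def)
  also have "\<dots> \<longleftrightarrow> \<bar>sinh (r / 2)\<bar> < \<bar>sinh (R / 2)\<bar>" using r0 R by simp
  also have "\<dots> \<longleftrightarrow> (sinh (r / 2))\<^sup>2 < (sinh (R / 2))\<^sup>2"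
    by (simp only: abs_le_square_iff flip: not_le)
  also have "\<dots> \<longleftrightarrow> (a - b)\<^sup>2 < (sinh (R / 2))\<^sup>2 * ((1 - a\<^sup>2) * (1 - b\<^sup>2))"
    unfolding r using pos by (simp add: divide_less_eq)
  finally show ?thesis .
qed

text \<open>
  Linear in \<open>b\<close> on either side of \<open>a\<close>, this form locates the endpoints of the \<open>\<rho>\<close>-interval,
  whereas the \<open>sinh\<close> form matches the bound on \<open>R\<^sub>1\<close>.
\<close>

lemma rho_ball_diameter_tanh:
  fixes e :: "real ^ 'n"
  assumes e: "norm e = 1" and a: "\<bar>a\<bar> < 1" and b: "\<bar>b\<bar> < 1" and R: "R > 0"
  shows "b *\<^sub>R e \<in> rho_ball (a *\<^sub>R e) R \<longleftrightarrow> \<bar>a - b\<bar> < tanh (R / 2) * (1 - a * b)"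
proof -
  let ?S = "sinh (R / 2)" and ?C = "cosh (R / 2)"
  have C: "?C > 0" and S: "?S > 0" using R by simp_all
  have "\<bar>a * b\<bar> < 1" using a b mult_strict_mono'[of "\<bar>a\<bar>" 1 "\<bar>b\<bar>" 1] by (simp add: abs_mult)
  then have ab: "1 - a * b > 0" by linarith
  have "b *\<^sub>R e \<in> rho_ball (a *\<^sub>R e) R \<longleftrightarrow> (a - b)\<^sup>2 < ?S\<^sup>2 * ((1 - a * b)\<^sup>2 - (a - b)\<^sup>2)"
    unfolding rho_ball_diameter_sinh[OF assms] by (simp add: power2_eq_square algebra_simps)
  also have "\<dots> \<longleftrightarrow> (\<bar>a - b\<bar> * ?C)\<^sup>2 < (?S * (1 - a * b))\<^sup>2"
    unfolding power_mult_distrib cosh_square_eq by (simp add: algebra_simps)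
  also have "\<dots> \<longleftrightarrow> \<bar>a - b\<bar> * ?C < ?S * (1 - a * b)"
    using C S ab by (intro iffI power_strict_mono) (auto intro: power2_less_imp_less)
  also have "\<dots> \<longleftrightarrow> \<bar>a - b\<bar> < tanh (R / 2) * (1 - a * b)"
    using C by (simp add: tanh_def pos_less_divide_eq)
  finally show ?thesis .
qed

section \<open>Radii of hyperbolic balls containing triangular ratio balls\<close>

text \<open>
  The test point is the endpoint of the \<open>\<rho>\<close>-interval in the direction \<open>-e\<close>.  It has
  hyperbolic distance exactly \<open>R\<close> from the centre, so it lies outside the \<open>\<rho>\<close>-ball and hence
  outside the \<open>s\<close>-ball.
\<close>

lemma s_ball_subset_rho_ball_imp_triangular_radius_le:
  fixes e :: "real ^ 'n"
  assumes e: "norm e = 1" and a: "0 \<le> a" "a < 1" and R: "R > 0"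
    and sub: "s_ball (a *\<^sub>R e) t \<subseteq> rho_ball (a *\<^sub>R e) R"
  defines "T \<equiv> tanh (R / 2)"
  shows "t \<le> T * (1 - a\<^sup>2) / (2 * (1 - a * T) - \<bar>2 * a - T * (1 + a\<^sup>2)\<bar>)"
proof -
  have T: "0 < T" "T < 1" using R by (auto simp: T_def tanh_real_lt_1)
  have "a * T < 1" using a T mult_strict_mono'[of a 1 T 1] by simp
  then have p: "1 - a * T > 0" by simp
  define b where "b = (a - T) / (1 - a * T)"
  have "(1 - T) * (1 + a) > 0" "(1 + T) * (1 - a) > 0" using a T by simp_all
  then have b: "\<bar>b\<bar> < 1"
    unfolding b_def using p by (simp add: abs_less_iff field_simps)
  have diff: "a - b = T * (1 - a\<^sup>2) / (1 - a * T)"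
    and sum: "a + b = (2 * a - T * (1 + a\<^sup>2)) / (1 - a * T)"
    and prod: "1 - a * b = (1 - a\<^sup>2) / (1 - a * T)"
    unfolding b_def using p by (simp_all add: field_simps power2_eq_square)
  have "a\<^sup>2 < 1" using a by (simp add: abs_square_less_1)
  then have absdiff: "\<bar>a - b\<bar> = T * (1 - a\<^sup>2) / (1 - a * T)"
    unfolding diff using p T by simp
  have "b *\<^sub>R e \<notin> rho_ball (a *\<^sub>R e) R"
    using rho_ball_diameter_tanh[OF e _ b R, of a] a absdiff prod by (simp flip: T_def)
  then have "t * (2 - \<bar>a + b\<bar>) \<le> \<bar>a - b\<bar>"
    using sub s_ball_diameter[OF e _ b, of a t] a by auto
  moreover have "2 - \<bar>a + b\<bar> > 0" using a b by linarith
  ultimately have "t \<le> \<bar>a - b\<bar> / (2 - \<bar>a + b\<bar>)" by (simp add: pos_le_divide_eq)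
  also have "2 - \<bar>a + b\<bar> = (2 * (1 - a * T) - \<bar>2 * a - T * (1 + a\<^sup>2)\<bar>) / (1 - a * T)"
    unfolding sum using p by (simp add: field_simps)
  finally show ?thesis using p by (simp add: absdiff)
qed

text \<open>
  The two inequalities in the last hypothesis are the cases of \<open>|a + b|\<close> in the formula for
  \<open>s\<close>, so every \<open>b\<close> strictly between \<open>c\<close> and \<open>a\<close> gives a point of the \<open>s\<close>-ball and hence of
  the \<open>\<rho>\<close>-ball.  Letting \<open>b\<close> tend to \<open>c\<close> bounds the hyperbolic distance at \<open>c\<close> by \<open>R\<close>.
\<close>

lemma s_interval_imp_sinh_bound:
  fixes e :: "real ^ 'n"
  assumes e: "norm e = 1" and a: "0 \<le> a" "a < 1" and R: "R > 0"
    and sub: "s_ball (a *\<^sub>R e) t \<subseteq> rho_ball (a *\<^sub>R e) R"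
    and c: "- 1 < c" "c < a"
    and inside: "\<And>b. c < b \<Longrightarrow> b < a \<Longrightarrow> a - b < t * (2 - a - b) \<and> a - b < t * (2 + a + b)"
  shows "(a - c)\<^sup>2 \<le> (sinh (R / 2))\<^sup>2 * ((1 - a\<^sup>2) * (1 - c\<^sup>2))"
proof -
  let ?f = "\<lambda>b. (sinh (R / 2))\<^sup>2 * ((1 - a\<^sup>2) * (1 - b\<^sup>2)) - (a - b)\<^sup>2"
  have "?f b > 0" if "c < b" "b < a" for b
  proof -
    have b: "\<bar>b\<bar> < 1" and a': "\<bar>a\<bar> < 1" using that a c by auto
    have "\<bar>a - b\<bar> < t * (2 - \<bar>a + b\<bar>)"
      using inside[OF that] that by (cases "a + b \<ge> 0") (simp_all add: algebra_simps)
    then have "b *\<^sub>R e \<in> rho_ball (a *\<^sub>R e) R"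
      using s_ball_diameter[OF e a' b] sub by auto
    then show ?thesis using rho_ball_diameter_sinh[OF e a' b R] by simp
  qed
  then have "?f b \<ge> 0" if "b \<in> {c<..<a}" for b using that by (simp add: less_imp_le)
  then have "?f c \<ge> 0"
    using c continuous_ge_on_closure[where S = "{c<..<a}" and f = ?f and x = c and a = 0]
    by (simp add: continuous_intros)
  then show ?thesis by simp
qed

lemma arsinh_le_half_radius:
  fixes R t l m :: real
  assumes R: "R > 0" and t: "t > 0" and m: "m > 0" "m \<le> l" and le: "4 * t\<^sup>2 \<le> (sinh (R / 2))\<^sup>2 * m"
  shows "2 * arsinh (2 * t / sqrt l) \<le> R"
proof -
  have "(2 * t)\<^sup>2 \<le> (sinh (R / 2) * sqrt l)\<^sup>2"
  proof -
    have "(2 * t)\<^sup>2 \<le> (sinh (R / 2))\<^sup>2 * m" using le by (simp add: power2_eq_square)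
    also have "\<dots> \<le> (sinh (R / 2))\<^sup>2 * l" using m by (intro mult_left_mono) auto
    also have "\<dots> = (sinh (R / 2) * sqrt l)\<^sup>2" using m by (simp add: power_mult_distrib)
    finally show ?thesis .
  qed
  then have "2 * t \<le> sinh (R / 2) * sqrt l"
    by (rule power2_le_imp_le) (use R m in simp_all)
  then have "2 * t / sqrt l \<le> sinh (R / 2)" using m by (simp add: pos_divide_le_eq)
  then have "\<not> arsinh (sinh (R / 2)) < arsinh (2 * t / sqrt l)"
    by (simp only: arsinh_less_iff_real not_less)
  then show ?thesis by (simp add: arsinh_sinh_real)
qed

text \<open>
  The points \<open>c1\<close> and \<open>c2\<close> below solve \<open>a - c = t (2 - (a + c))\<close> and \<open>a - c = t (2 + (a + c))\<close>,
  the two linear cases of \<open>a - c = t (2 - |a + c|)\<close>.  The \<open>s\<close>-interval ends at the larger of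
  them, and there \<open>sinh\<^sup>2 (\<rho>/2) = 4t\<^sup>2/m\<close>, where \<open>m\<close> is the corresponding entry of the maximum
  \<open>l_fun\<close>.  This entry is positive because the endpoint lies inside the unit ball, and the
  maximum is at least as large.
\<close>

lemma s_ball_subset_rho_ball_imp_hyperbolic_radius_ge:
  fixes e :: "real ^ 'n"
  assumes e: "norm e = 1" and a: "0 \<le> a" "a < 1" and R: "R > 0" and t: "0 < t" "t < 1"
    and sub: "s_ball (a *\<^sub>R e) t \<subseteq> rho_ball (a *\<^sub>R e) R"
  shows "2 * arsinh (2 * t / sqrt (l_fun t a)) \<le> R"
proof -
  define c1 where "c1 = (a * (1 + t) - 2 * t) / (1 - t)"
  define c2 where "c2 = (a * (1 - t) - 2 * t) / (1 + t)"
  let ?m1 = "(1 + t) * (1 + a) * (1 - 3 * t + a * (1 + t))"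
  let ?m2 = "(1 - t) * (1 - a) * (1 + 3 * t - a * (1 - t))"
  let ?S = "(sinh (R / 2))\<^sup>2"
  have sq: "1 - c\<^sup>2 = (1 - c) * (1 + c)" for c :: real
    by (simp add: power2_eq_square algebra_simps)
  have diff1: "a - c1 = 2 * t * (1 - a) / (1 - t)"
    and minus1: "1 - c1 = (1 - a) * (1 + t) / (1 - t)"
    and plus1: "1 + c1 = (1 - 3 * t + a * (1 + t)) / (1 - t)"
    unfolding c1_def using t by (simp_all add: field_simps)
  have diff2: "a - c2 = 2 * t * (1 + a) / (1 + t)"
    and minus2: "1 - c2 = (1 + 3 * t - a * (1 - t)) / (1 + t)"
    and plus2: "1 + c2 = (1 + a) * (1 - t) / (1 + t)"
    unfolding c2_def using t by (simp_all add: field_simps)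
  have sq1: "(1 - a\<^sup>2) * (1 - c1\<^sup>2) = ?m1 * ((1 - a) / (1 - t))\<^sup>2"
    unfolding sq minus1 plus1 by (simp add: power2_eq_square ac_simps)
  have sq2: "(1 - a\<^sup>2) * (1 - c2\<^sup>2) = ?m2 * ((1 + a) / (1 + t))\<^sup>2"
    unfolding sq minus2 plus2 by (simp add: power2_eq_square ac_simps)
  have below: "c1 < a" "c2 < a"
    using diff1 diff2 t a by (smt (verit) divide_pos_pos mult_pos_pos)+
  have c2: "- 1 < c2" using plus2 t a by (smt (verit) divide_pos_pos mult_pos_pos)
  have ineq1: "a - b < t * (2 - a - b)" if "c1 < b" for b
    using that t unfolding c1_def by (simp add: pos_divide_less_eq algebra_simps)
  have ineq2: "a - b < t * (2 + a + b)" if "c2 < b" for b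
    using that t unfolding c2_def by (simp add: pos_divide_less_eq algebra_simps)
  show ?thesis
  proof (cases "c1 \<ge> c2")
    case True
    then have c1: "- 1 < c1" using c2 by simp
    then have pos: "1 - 3 * t + a * (1 + t) > 0"
      using plus1 t by (smt (verit) divide_nonpos_pos)
    have "(a - c1)\<^sup>2 \<le> ?S * ((1 - a\<^sup>2) * (1 - c1\<^sup>2))"
      using ineq1 ineq2 True
      by (intro s_interval_imp_sinh_bound[OF e a R sub c1 below(1)]) auto
    also have "(a - c1)\<^sup>2 = 4 * t\<^sup>2 * ((1 - a) / (1 - t))\<^sup>2"
      unfolding diff1 by (simp add: power2_eq_square)
    also have "?S * ((1 - a\<^sup>2) * (1 - c1\<^sup>2)) = ?S * ?m1 * ((1 - a) / (1 - t))\<^sup>2"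
      unfolding sq1 by simp
    finally have "4 * t\<^sup>2 \<le> ?S * ?m1" using a t by simp
    moreover have "?m1 > 0" using pos a t by simp
    ultimately show ?thesis
      by (intro arsinh_le_half_radius[OF R t(1)]) (auto simp: l_fun_def)
  next
    case False
    have "a * (1 - t) < 1 - t" using mult_strict_right_mono[of a 1 "1 - t"] a t by simp
    then have "1 + 3 * t - a * (1 - t) > 0" using t by (simp add: algebra_simps)
    then have "?m2 > 0" using a t by simp
    moreover have "4 * t\<^sup>2 \<le> ?S * ?m2"
    proof -
      have "(a - c2)\<^sup>2 \<le> ?S * ((1 - a\<^sup>2) * (1 - c2\<^sup>2))"
        using ineq1 ineq2 False
        by (intro s_interval_imp_sinh_bound[OF e a R sub c2 below(2)]) auto
      also have "(a - c2)\<^sup>2 = 4 * t\<^sup>2 * ((1 + a) / (1 + t))\<^sup>2"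
        unfolding diff2 by (simp add: power2_eq_square)
      also have "?S * ((1 - a\<^sup>2) * (1 - c2\<^sup>2)) = ?S * ?m2 * ((1 + a) / (1 + t))\<^sup>2"
        unfolding sq2 by simp
      finally show ?thesis using a t by simp
    qed
    ultimately show ?thesis
      by (intro arsinh_le_half_radius[OF R t(1)]) (auto simp: l_fun_def)
  qed
qed

section \<open>Radii of triangular ratio balls containing hyperbolic balls\<close>

text \<open>
  The \<open>\<rho>\<close>-interval ends at \<open>d = (a + T)/(1 + aT)\<close> in the direction \<open>e\<close>,
  where \<open>T = tanh (R/2) = (E - 1)/(E + 1)\<close> and \<open>E = exp R\<close>.  Points just before \<open>d\<close> lie in
  both balls, and the inequality for \<open>s\<close> survives the limit.  Clearing denominators puts the
  bound in a form that can be solved both for \<open>t\<close> and for \<open>E\<close>.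
\<close>

lemma rho_ball_subset_s_ball_imp_radii_inequality:
  fixes e :: "real ^ 'n"
  assumes e: "norm e = 1" and a: "0 \<le> a" "a < 1" and R: "R > 0"
    and sub: "rho_ball (a *\<^sub>R e) R \<subseteq> s_ball (a *\<^sub>R e) t"
  shows "(1 + a) * (exp R - 1) \<le> t * (3 + exp R + a * (exp R - 1))"
proof -
  define E where "E = exp R"
  have E: "E > 1" using R by (simp add: E_def)
  have T: "tanh (R / 2) = (E - 1) / (E + 1)"
  proof -
    have "tanh (R / 2) = (1 - 1 / E) / (1 + 1 / E)"
      by (simp add: tanh_real_altdef E_def exp_minus inverse_eq_divide)
    also have "\<dots> = (E - 1) / (E + 1)" using E by (simp add: divide_simps)
    finally show ?thesis .
  qed
  define q where "q = E + 1 + a * (E - 1)"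
  have q: "q > 0" using E a by (simp add: q_def add_pos_nonneg)
  define d where "d = (a * (E + 1) + (E - 1)) / q"
  have diff: "d - a = (1 - a) / q * ((1 + a) * (E - 1))"
    and one: "1 - d = 2 * (1 - a) / q"
    and rest: "2 - a - d = (1 - a) / q * (3 + E + a * (E - 1))"
    unfolding d_def using q by (simp_all add: field_simps, simp_all add: q_def algebra_simps)
  have ad: "a < d" using diff E a q by (smt (verit) divide_pos_pos mult_pos_pos)
  have d1: "d < 1" using one a q by (smt (verit) divide_pos_pos)
  have "t * (2 - a - b) - (b - a) \<ge> 0" if "b \<in> {a<..<d}" for b
  proof -
    have b: "\<bar>b\<bar> < 1" and a': "\<bar>a\<bar> < 1" using that a d1 by auto
    have "b * q < a * (E + 1) + (E - 1)"
      using that q by (simp add: d_def pos_less_divide_eq)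
    then have "(b - a) * (E + 1) < (E - 1) * (1 - a * b)"
      by (simp add: q_def algebra_simps)
    then have "b - a < (E - 1) / (E + 1) * (1 - a * b)"
      using E by (simp add: pos_less_divide_eq)
    then have "b *\<^sub>R e \<in> rho_ball (a *\<^sub>R e) R"
      using rho_ball_diameter_tanh[OF e a' b R] that by (simp add: T)
    then have "\<bar>a - b\<bar> < t * (2 - \<bar>a + b\<bar>)"
      using sub s_ball_diameter[OF e a' b] by auto
    then show ?thesis using that a by (simp add: algebra_simps)
  qed
  then have "t * (2 - a - d) - (d - a) \<ge> 0"
    using ad continuous_ge_on_closure[where S = "{a<..<d}" and x = d and a = 0
        and f = "\<lambda>b. t * (2 - a - b) - (b - a)"]
    by (simp add: continuous_intros)
  then have "(1 - a) / q * ((1 + a) * (E - 1)) \<le> (1 - a) / q * (t * (3 + E + a * (E - 1)))"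
    unfolding diff rest by (simp only: diff_ge_0_iff_ge mult.left_commute)
  moreover have "(1 - a) / q > 0" using a q by simp
  ultimately show ?thesis unfolding E_def by (simp only: mult_le_cancel_left_pos)
qed

section \<open>Necessary conditions on the radii\<close>

theorem lemma5p3:
  fixes x :: "real ^ 'n"
  assumes "x \<in> ball 0 1"
  shows
    "(\<forall>R>0. \<forall>t0>0. \<forall>t1>0.
        s_ball x t0 \<subseteq> rho_ball x R \<and> rho_ball x R \<subseteq> s_ball x t1 \<longrightarrow>
          (0 < t0 \<and>
           t0 \<le> tanh (R / 2) * (1 - (norm x)\<^sup>2) /
                 (2 * (1 - norm x * tanh (R / 2))
                    - \<bar>2 * norm x - tanh (R / 2) * (1 + (norm x)\<^sup>2)\<bar>)) \<and>
          t1 \<ge> (1 + norm x) * (exp R - 1) / (3 + exp R + norm x * (exp R - 1)))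
     \<and>
     (\<forall>t. 0 < t \<and> t < 1 \<longrightarrow>
        (\<forall>R0>0. \<forall>R1>0.
          rho_ball x R0 \<subseteq> s_ball x t \<and> s_ball x t \<subseteq> rho_ball x R1 \<longrightarrow>
            (0 < R0 \<and> R0 \<le> ln (1 + 4 * t / ((1 - t) * (1 + norm x)))) \<and>
            R1 \<ge> 2 * arsinh (2 * t / sqrt (l_fun t (norm x)))))"
proof -
  define a where "a = norm x"
  have a: "0 \<le> a" "a < 1" using assms by (auto simp: a_def)
  obtain e where e: "norm e = 1" and x: "x = a *\<^sub>R e"
  proof (cases "x = 0")
    case True
    \<comment> \<open>For \<open>x = 0\<close> every diameter passes through \<open>x\<close>.\<close>
    obtain e :: "real ^ 'n" where "norm e = 1" using vector_choose_size[of 1] by auto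
    then show ?thesis using True that by (auto simp: a_def)
  next
    case False
    then show ?thesis using that[of "sgn x"] by (simp add: a_def norm_sgn sgn_div_norm)
  qed
  have inner: "t \<le> tanh (R / 2) * (1 - a\<^sup>2) /
      (2 * (1 - a * tanh (R / 2)) - \<bar>2 * a - tanh (R / 2) * (1 + a\<^sup>2)\<bar>)"
    if "R > 0" "s_ball x t \<subseteq> rho_ball x R" for R t
    using s_ball_subset_rho_ball_imp_triangular_radius_le[OF e a] that by (simp add: x)
  have outer: "(1 + a) * (exp R - 1) \<le> t * (3 + exp R + a * (exp R - 1))"
    if "R > 0" "rho_ball x R \<subseteq> s_ball x t" for R t
    using rho_ball_subset_s_ball_imp_radii_inequality[OF e a] that by (simp add: x)
  have outer_t: "(1 + a) * (exp R - 1) / (3 + exp R + a * (exp R - 1)) \<le> t"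
    if "R > 0" "rho_ball x R \<subseteq> s_ball x t" for R t
  proof -
    have "3 + exp R + a * (exp R - 1) > 0" using a that by (simp add: add_pos_nonneg)
    then show ?thesis using outer[OF that] by (simp add: pos_divide_le_eq)
  qed
  have outer_R: "R \<le> ln (1 + 4 * t / ((1 - t) * (1 + a)))"
    if "R > 0" "rho_ball x R \<subseteq> s_ball x t" "0 < t" "t < 1" for R t
  proof -
    have p: "(1 - t) * (1 + a) > 0" using that a by simp
    have "(exp R - 1) * ((1 - t) * (1 + a)) \<le> 4 * t"
      using outer[OF that(1,2)] by (simp add: algebra_simps)
    then have "exp R - 1 \<le> 4 * t / ((1 - t) * (1 + a))"
      using p by (simp only: pos_le_divide_eq)
    then have "exp R \<le> 1 + 4 * t / ((1 - t) * (1 + a))" by linarith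
    then show ?thesis by (simp only: ln_ge_iff order_less_le_trans[OF exp_gt_zero])
  qed
  have inner_R: "2 * arsinh (2 * t / sqrt (l_fun t a)) \<le> R"
    if "R > 0" "s_ball x t \<subseteq> rho_ball x R" "0 < t" "t < 1" for R t
    using s_ball_subset_rho_ball_imp_hyperbolic_radius_ge[OF e a] that by (simp add: x)
  show ?thesis
    unfolding a_def[symmetric] using inner outer_t outer_R inner_R by blast
qed

end
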